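(* Let $W$ be a finite Coxeter group with set of fundamental reflections $R$, and let $r\in R$. Then \[|\Delta_1(r)|=\frac{|\mathcal{I}(W)|-1}{2}.\] Moreover, for every $x\in\mathcal{I}(W)\setminus R$, \[|\Delta_1(x)|<\frac{|\mathcal{I}(W)|-1}{2}.\]
   Context: $\ell$ is the length function of $W$ with respect to $R$. $\mathcal{I}(W)$ is the set of elements of $W$ of order exactly $2$. The excess zero graph $\mathcal{E}_0(W)$ has vertex set $\mathcal{I}(W)$, with $x,y$ adjacent whenever $\ell(xy)=\ell(x)+\ell(y)$. For $x\in\mathcal{I}(W)$, $\Delta_1(x)=\{y\in\mathcal{I}(W) : \ell(xy)=\ell(x)+\ell(y)\}$ is the set of neighbours of $x$. *)

theory Defs
  imports "HOL-Algebra.Elementary_Groups" "HOL-Algebra.Multiplicative_Group"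
begin

text \<open>
  Words in generators and their formal inverses: the letter \<open>(s, True)\<close> stands for \<open>s\<close> and
  \<open>(s, False)\<close> for its inverse. \<open>pres_step S Rel\<close> removes one cancelling pair or one relator, so
  the classes of words over \<open>S\<close> under the equivalence relation it generates are the elements
  of the presented group \<open>\<langle>S | Rel\<rangle>\<close>.
\<close>

type_synonym 'a word = "('a \<times> bool) list"

definition words_over :: "'a set \<Rightarrow> 'a word set" where
  "words_over S = lists (S \<times> UNIV)"

inductive pres_step :: "'a set \<Rightarrow> 'a word set \<Rightarrow> 'a word \<Rightarrow> 'a word \<Rightarrow> bool"
  for S :: "'a set" and Rel :: "'a word set" where
  cancel: "\<lbrakk>u \<in> words_over S; v \<in> words_over S; s \<in> S\<rbrakk>
    \<Longrightarrow> pres_step S Rel (u @ [(s, b), (s, \<not> b)] @ v) (u @ v)"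
| relator: "\<lbrakk>u \<in> words_over S; v \<in> words_over S; q \<in> Rel\<rbrakk>
    \<Longrightarrow> pres_step S Rel (u @ q @ v) (u @ v)"

definition pres_equiv :: "'a set \<Rightarrow> 'a word set \<Rightarrow> 'a word \<Rightarrow> 'a word \<Rightarrow> bool" where
  "pres_equiv S Rel = equivclp (pres_step S Rel)"

definition letter_val :: "('a, 'b) monoid_scheme \<Rightarrow> 'a \<times> bool \<Rightarrow> 'a" where
  "letter_val G l = (if snd l then fst l else inv\<^bsub>G\<^esub> (fst l))"

definition word_val :: "('a, 'b) monoid_scheme \<Rightarrow> 'a word \<Rightarrow> 'a" where
  "word_val G w = foldr (\<lambda>l x. letter_val G l \<otimes>\<^bsub>G\<^esub> x) w \<one>\<^bsub>G\<^esub>"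

text \<open>
  \<open>G\<close> has the presentation \<open>\<langle>S | Rel\<rangle>\<close>: the canonical map from the presented group to \<open>G\<close>,
  induced by evaluation of words, is a well-defined bijection.
\<close>

definition has_presentation :: "('a, 'b) monoid_scheme \<Rightarrow> 'a set \<Rightarrow> 'a word set \<Rightarrow> bool" where
  "has_presentation G S Rel \<longleftrightarrow>
     group G \<and> S \<subseteq> carrier G \<and> Rel \<subseteq> words_over S \<and> generate G S = carrier G \<and>
     (\<forall>u\<in>words_over S. \<forall>v\<in>words_over S. word_val G u = word_val G v \<longleftrightarrow> pres_equiv S Rel u v)"

text \<open>
  In a Coxeter matrix the entry \<open>0\<close> encodes \<open>\<infinity>\<close>; the corresponding relator is then the empty
  word, i.e. no relation is imposed.
\<close>

definition coxeter_matrix :: "'a set \<Rightarrow> ('a \<Rightarrow> 'a \<Rightarrow> nat) \<Rightarrow> bool" where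
  "coxeter_matrix S m \<longleftrightarrow>
     (\<forall>s\<in>S. m s s = 1) \<and> (\<forall>s\<in>S. \<forall>t\<in>S. m s t = m t s) \<and> (\<forall>s\<in>S. \<forall>t\<in>S. s \<noteq> t \<longrightarrow> m s t \<noteq> 1)"

definition coxeter_relators :: "'a set \<Rightarrow> ('a \<Rightarrow> 'a \<Rightarrow> nat) \<Rightarrow> 'a word set" where
  "coxeter_relators S m =
     {concat (replicate (m s t) [(s, True), (t, True)]) | s t. s \<in> S \<and> t \<in> S}"

definition coxeter_system :: "('a, 'b) monoid_scheme \<Rightarrow> 'a set \<Rightarrow> bool" where
  "coxeter_system W R \<longleftrightarrow>
     (\<exists>m. coxeter_matrix R m \<and> has_presentation W R (coxeter_relators R m))"

text \<open>
  Words in \<open>R\<close> without inverses suffice for the length, as fundamental reflections are involutions.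
\<close>

definition cox_length :: "('a, 'b) monoid_scheme \<Rightarrow> 'a set \<Rightarrow> 'a \<Rightarrow> nat" where
  "cox_length W R w =
     (LEAST n. \<exists>rs. set rs \<subseteq> R \<and> length rs = n \<and> foldr (\<otimes>\<^bsub>W\<^esub>) rs \<one>\<^bsub>W\<^esub> = w)"

definition involutions :: "('a, 'b) monoid_scheme \<Rightarrow> 'a set" where
  "involutions W = {x \<in> carrier W. group.ord W x = 2}"

text \<open>The neighbours of \<open>x\<close> in the excess zero graph.\<close>

definition Delta1 :: "('a, 'b) monoid_scheme \<Rightarrow> 'a set \<Rightarrow> 'a \<Rightarrow> 'a set" where
  "Delta1 W R x =
     {y \<in> involutions W. cox_length W R (x \<otimes>\<^bsub>W\<^esub> y) = cox_length W R x + cox_length W R y}"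

end

theory Submission
  imports Defs
begin

text \<open>
  On \<open>\<I>(W) - {r}\<close> the map sending \<open>y\<close> to \<open>ry\<close> if \<open>r\<close> and \<open>y\<close> commute, and to \<open>ryr\<close> otherwise,
  is an involution exchanging the \<open>y\<close> with \<open>\<ell>(ry) > \<ell>(y)\<close> and those with \<open>\<ell>(ry) < \<ell>(y)\<close>; this is
  the equality. If \<open>x\<close> is an involution with a reduced word ending in \<open>r\<close>, then
  \<open>\<Delta>\<^sub>1(x) \<subseteq> \<Delta>\<^sub>1(r)\<close>. For \<open>\<ell>(x) \<ge> 3\<close> the inclusion is strict because the partner of the longest
  element under the above map lies in \<open>\<Delta>\<^sub>1(r)\<close> and has colength at most \<open>2\<close>; for \<open>x = sr\<close> of
  length \<open>2\<close>, the reflection \<open>s\<close> lies in \<open>\<Delta>\<^sub>1(r) - \<Delta>\<^sub>1(x)\<close>. The exchange condition comes from the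
  action of \<open>W\<close> on reflections with signs.
\<close>

section \<open>Words in the generators and maps that respect the presentation\<close>

locale coxeter_group = group W for W (structure) +
  fixes R :: "'a set"
  assumes cox: "coxeter_system W R"
begin

abbreviation word_prod :: "'a list \<Rightarrow> 'a" where
  "word_prod rs \<equiv> foldr (\<otimes>) rs \<one>"

abbreviation len :: "'a \<Rightarrow> nat" where
  "len \<equiv> cox_length W R"

lemma R_carrier: "R \<subseteq> carrier W"
  using cox by (auto simp: coxeter_system_def has_presentation_def)

lemma R_closed [simp]: "s \<in> R \<Longrightarrow> s \<in> carrier W"
  using R_carrier by auto

lemma word_prod_closed [simp]: "set rs \<subseteq> R \<Longrightarrow> word_prod rs \<in> carrier W"
  by (induction rs) auto

lemma word_prod_append:
  "set us \<subseteq> R \<Longrightarrow> set vs \<subseteq> R \<Longrightarrow> word_prod (us @ vs) = word_prod us \<otimes> word_prod vs"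
  by (induction us) (auto simp: m_assoc simp del: foldr_append)

lemma foldr_concat_replicate:
  "foldr g (concat (replicate n [a, b])) = (g a \<circ> g b) ^^ n"
  by (induction n) (auto simp: fun_eq_iff)

text \<open>The universal property of the presentation, for actions: self-inverse maps satisfying
  the Coxeter relations act through the presented group. The sign of a letter is ignored, which is
  sound because each \<open>f s\<close> is its own inverse.\<close>

lemma foldr_pres_equiv:
  fixes f :: "'a \<Rightarrow> 'c \<Rightarrow> 'c"
  assumes inv: "\<And>s. s \<in> R \<Longrightarrow> f s \<circ> f s = id"
    and rel: "\<And>s t. s \<in> R \<Longrightarrow> t \<in> R \<Longrightarrow> (f s \<circ> f t) ^^ m s t = id"
    and equiv: "pres_equiv R (coxeter_relators R m) u v"
  shows "foldr (\<lambda>l. f (fst l)) u = foldr (\<lambda>l. f (fst l)) v"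
proof -
  have step: "foldr (\<lambda>l. f (fst l)) u = foldr (\<lambda>l. f (fst l)) v"
    if "pres_step R (coxeter_relators R m) u v" for u v
    using that
  proof cases
    case (cancel u' v' s b)
    have "f s (f s x) = x" for x
      using inv[OF cancel(5)] by (metis comp_apply id_apply)
    then show ?thesis using cancel(1,2) by (simp add: fun_eq_iff)
  next
    case (relator u' v' q)
    then obtain s t where "s \<in> R" "t \<in> R"
      and q: "q = concat (replicate (m s t) [(s, True), (t, True)])"
      by (auto simp: coxeter_relators_def)
    then have "foldr (\<lambda>l. f (fst l)) q = id"
      using rel[of s t] by (simp add: foldr_concat_replicate)
    then show ?thesis using relator(1,2) by (simp add: fun_eq_iff)
  qed
  show ?thesis
    using equiv unfolding pres_equiv_def
    by (induction rule: equivclp_induct) (auto dest: step)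
qed

lemma word_val_map: "word_val W (map (\<lambda>s. (s, True)) rs) = word_prod rs"
  by (induction rs) (auto simp: word_val_def letter_val_def)

text \<open>Both directions of the presentation: the relations hold in \<open>W\<close>, and equal
  products come from equivalent words. Only positive letters occur, so plain lists over
  \<open>R\<close> can replace signed words.\<close>

lemma coxeter_exponents:
  obtains m where "\<And>s. s \<in> R \<Longrightarrow> m s s = 1"
    and "\<And>s t. s \<in> R \<Longrightarrow> t \<in> R \<Longrightarrow> (s \<otimes> t) [^] (m s t :: nat) = \<one>"
    and "\<And>us vs. set us \<subseteq> R \<Longrightarrow> set vs \<subseteq> R \<Longrightarrow> word_prod us = word_prod vs \<Longrightarrow>
      pres_equiv R (coxeter_relators R m) (map (\<lambda>s. (s, True)) us) (map (\<lambda>s. (s, True)) vs)"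
proof -
  obtain m where m: "coxeter_matrix R m" and pres: "has_presentation W R (coxeter_relators R m)"
    using cox by (auto simp: coxeter_system_def)
  have words: "map (\<lambda>s. (s, True)) us \<in> words_over R" if "set us \<subseteq> R" for us
    using that by (auto simp: words_over_def in_lists_conv_set)
  have pow: "word_prod (concat (replicate n [s, t])) = (s \<otimes> t) [^] n"
    if "s \<in> R" "t \<in> R" for s t and n :: nat
  proof (induction n)
    case (Suc n)
    have "word_prod (concat (replicate (Suc n) [s, t])) = (s \<otimes> t) \<otimes> (s \<otimes> t) [^] n"
      using that Suc by (simp add: m_assoc)
    also have "\<dots> = (s \<otimes> t) [^] Suc n"
      using that by (intro nat_pow_Suc2[symmetric]) simp
    finally show ?case .
  qed simp
  show thesis
  proof (rule that[of m])
    show "m s s = 1" if "s \<in> R" for s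
      using m that by (auto simp: coxeter_matrix_def)
    show "(s \<otimes> t) [^] m s t = \<one>" if st: "s \<in> R" "t \<in> R" for s t
    proof -
      let ?q = "concat (replicate (m s t) [s, t])"
      have q: "map (\<lambda>s. (s, True)) ?q = concat (replicate (m s t) [(s, True), (t, True)])"
        by (simp add: map_concat)
      \<comment> \<open>A relator in empty context reduces to the empty word, hence evaluates to
        \<open>\<one>\<close>; for \<open>m s t = 0\<close> it is itself empty.\<close>
      have "pres_step R (coxeter_relators R m) ([] @ map (\<lambda>s. (s, True)) ?q @ []) ([] @ [])"
        unfolding q using st
        by (intro pres_step.relator) (auto simp: words_over_def coxeter_relators_def)
      then have "pres_equiv R (coxeter_relators R m)
          (map (\<lambda>s. (s, True)) ?q) (map (\<lambda>s. (s, True)) [])"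
        by (auto simp: pres_equiv_def)
      moreover have "set ?q \<subseteq> R" using st by auto
      ultimately have "word_val W (map (\<lambda>s. (s, True)) ?q) = word_val W (map (\<lambda>s. (s, True)) [])"
        using pres words[of ?q] words[of "[]"] unfolding has_presentation_def by fastforce
      then show ?thesis using pow[OF st] by (simp only: word_val_map foldr.simps id_apply)
    qed
    show "pres_equiv R (coxeter_relators R m) (map (\<lambda>s. (s, True)) us) (map (\<lambda>s. (s, True)) vs)"
      if "set us \<subseteq> R" "set vs \<subseteq> R" "word_prod us = word_prod vs" for us vs
      using pres words that unfolding has_presentation_def by (metis word_val_map)
  qed
qed

lemma R_square [simp]: "s \<in> R \<Longrightarrow> s \<otimes> s = \<one>"
  by (rule coxeter_exponents) (metis R_closed m_closed nat_pow_eone)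

lemma R_square_left [simp]: "s \<in> R \<Longrightarrow> x \<in> carrier W \<Longrightarrow> s \<otimes> (s \<otimes> x) = x"
  by (simp add: m_assoc[symmetric])

lemma R_inv [simp]: "s \<in> R \<Longrightarrow> inv s = s"
  by (simp add: inv_equality)

lemma word_prod_rev: "set rs \<subseteq> R \<Longrightarrow> word_prod (rev rs) = inv (word_prod rs)"
  by (induction rs) (auto simp: word_prod_append inv_mult_group simp del: foldr_append)

section \<open>The action on signed reflections\<close>

text \<open>The classical permutation representation on reflections with signs, extended to all of
  \<open>carrier W\<close> so that reflections need not be singled out. Outside the carrier it is
  the identity, so that the relations hold as equations of total functions.\<close>

definition signed_conj :: "'a \<Rightarrow> 'a \<times> bool \<Rightarrow> 'a \<times> bool" where
  "signed_conj s p = (if fst p \<in> carrier W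
     then (s \<otimes> fst p \<otimes> s, snd p \<noteq> (fst p = s)) else p)"

lemma signed_conj_square: "s \<in> R \<Longrightarrow> signed_conj s \<circ> signed_conj s = id"
proof (rule ext)
  fix p assume s: "s \<in> R"
  have "s \<otimes> u \<otimes> s = s \<longleftrightarrow> u = s" if "u \<in> carrier W" for u
    using that s by (metis R_closed R_square l_one m_assoc m_closed r_one R_square_left)
  moreover have "s \<otimes> (s \<otimes> u \<otimes> s) \<otimes> s = u" if "u \<in> carrier W" for u
    using that s by (simp add: m_assoc)
  ultimately show "(signed_conj s \<circ> signed_conj s) p = id p"
    using s by (cases p) (auto simp: signed_conj_def)
qed

text \<open>
  The \<open>2n\<close> reflections met by the word \<open>(st)\<^sup>n\<close> are the \<open>u\<close> with \<open>(st)\<^sup>j u = t\<close>, \<open>j < 2n\<close>. For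
  \<open>(st)\<^sup>n = 1\<close> every one of them is met an even number of times.
\<close>

lemma signed_conj_pair_pow:
  assumes st: "s \<in> R" "t \<in> R" and u: "u \<in> carrier W"
  shows "((signed_conj s \<circ> signed_conj t) ^^ n) (u, b) =
    ((s \<otimes> t) [^] n \<otimes> u \<otimes> (t \<otimes> s) [^] n,
     b \<noteq> odd (card {j. j < 2 * n \<and> (s \<otimes> t) [^] j \<otimes> u = t}))"
proof (induction n)
  case 0
  then show ?case using u by simp
next
  case (Suc n)
  let ?c = "s \<otimes> t" and ?d = "t \<otimes> s"
  let ?v = "?c [^] n \<otimes> u \<otimes> ?d [^] n"
  have cl [simp]: "s \<in> carrier W" "t \<in> carrier W" using st by auto
  have d: "?d = inv ?c" using st by (simp add: inv_mult_group)
  have tc: "t \<otimes> ?c [^] k = ?d [^] k \<otimes> t" for k :: nat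
  proof (induction k)
    case (Suc k)
    have "t \<otimes> ?c [^] Suc k = t \<otimes> ?c [^] k \<otimes> ?c" by (simp add: m_assoc)
    also have "\<dots> = ?d [^] k \<otimes> (t \<otimes> (s \<otimes> t))" by (simp add: Suc m_assoc)
    finally show ?case by (simp add: m_assoc)
  qed simp
  have dc: "?d [^] k \<otimes> (?c [^] k \<otimes> x) = x" "?c [^] k \<otimes> (?d [^] k \<otimes> x) = x"
    if "x \<in> carrier W" for k :: nat and x
    using that by (simp_all add: d nat_pow_inv m_assoc[symmetric])
  have vw: "?v = w \<longleftrightarrow> ?c [^] n \<otimes> u = w \<otimes> ?c [^] n" if "w \<in> carrier W" for w
    using that u by (simp add: d nat_pow_inv inv_solve_right')
  have p2: "?c [^] (2 * n) \<otimes> u = ?c [^] n \<otimes> (?c [^] n \<otimes> u)"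
    using u by (simp add: mult_2 nat_pow_mult[symmetric] m_assoc)
  have flip: "x = ?d [^] k \<otimes> y \<longleftrightarrow> ?c [^] k \<otimes> x = y"
    if "x \<in> carrier W" "y \<in> carrier W" for k :: nat and x y
    using dc that by auto
  \<comment> \<open>A new round first applies \<open>signed_conj t\<close>; its sign flip is the
    index \<open>j = 2 * n\<close>.\<close>
  have e1: "?v = t \<longleftrightarrow> ?c [^] (2 * n) \<otimes> u = t"
    using u by (simp add: vw tc flip p2)
  \<comment> \<open>The flip by \<open>signed_conj s\<close> in the same round is the index
    \<open>j = 2 * n + 1\<close>.\<close>
  have "t \<otimes> ?v \<otimes> t = s \<longleftrightarrow> ?v = t \<otimes> (s \<otimes> t)"
  proof
    assume "t \<otimes> ?v \<otimes> t = s"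
    then have "t \<otimes> (t \<otimes> ?v \<otimes> t) \<otimes> t = t \<otimes> s \<otimes> t" by simp
    then show "?v = t \<otimes> (s \<otimes> t)" using u st by (simp add: m_assoc)
  next
    assume "?v = t \<otimes> (s \<otimes> t)"
    then show "t \<otimes> ?v \<otimes> t = s" using st by (simp add: m_assoc)
  qed
  also have "\<dots> \<longleftrightarrow> ?c [^] n \<otimes> u = ?d \<otimes> (t \<otimes> ?c [^] n)"
    using vw[of "t \<otimes> (s \<otimes> t)"] by (simp add: m_assoc)
  also have "?d \<otimes> (t \<otimes> ?c [^] n) = ?d [^] Suc n \<otimes> t"
    unfolding tc nat_pow_Suc2[OF m_closed[OF cl(2) cl(1)]] by (simp add: m_assoc)
  also have "?c [^] n \<otimes> u = ?d [^] Suc n \<otimes> t \<longleftrightarrow> ?c [^] Suc n \<otimes> (?c [^] n \<otimes> u) = t"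
    using u by (intro flip) auto
  also have "?c [^] Suc n \<otimes> (?c [^] n \<otimes> u) = ?c [^] (Suc n + n) \<otimes> u"
    using u by (simp add: nat_pow_mult[symmetric] m_assoc del: nat_pow_Suc add_Suc)
  also have "Suc n + n = Suc (2 * n)" by simp
  finally have e2: "t \<otimes> ?v \<otimes> t = s \<longleftrightarrow> ?c [^] Suc (2 * n) \<otimes> u = t" .
  let ?P = "\<lambda>j::nat. ?c [^] j \<otimes> u = t"
  have sets: "{j. j < 2 * Suc n \<and> ?P j} = {j. j < 2 * n \<and> ?P j} \<union>
     ((if ?P (2 * n) then {2 * n} else {}) \<union> (if ?P (Suc (2 * n)) then {Suc (2 * n)} else {}))"
    by (auto simp: less_Suc_eq simp del: nat_pow_Suc)
  have card: "card {j. j < 2 * Suc n \<and> ?P j} = card {j. j < 2 * n \<and> ?P j} +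
     ((if ?P (2 * n) then 1 else 0) + (if ?P (Suc (2 * n)) then 1 else 0))"
    unfolding sets by (subst card_Un_disjoint) (auto simp del: nat_pow_Suc)
  have conj: "s \<otimes> (t \<otimes> ?v \<otimes> t) \<otimes> s = ?c [^] Suc n \<otimes> u \<otimes> ?d [^] Suc n"
    unfolding nat_pow_Suc2[OF m_closed[OF cl]] using u by (simp add: m_assoc)
  have step: "signed_conj r (w, b') = (r \<otimes> w \<otimes> r, b' \<noteq> (w = r))"
    if "w \<in> carrier W" for r w b'
    using that by (simp add: signed_conj_def)
  let ?N = "card {j. j < 2 * n \<and> ?P j}"
  have v: "?v \<in> carrier W" "t \<otimes> ?v \<otimes> t \<in> carrier W" using u by auto
  have "((signed_conj s \<circ> signed_conj t) ^^ Suc n) (u, b) =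
      (s \<otimes> (t \<otimes> ?v \<otimes> t) \<otimes> s, ((b \<noteq> odd ?N) \<noteq> (?v = t)) \<noteq> (t \<otimes> ?v \<otimes> t = s))"
    unfolding funpow.simps comp_apply Suc.IH step[OF v(1)] step[OF v(2)] ..
  also have "\<dots> = (?c [^] Suc n \<otimes> u \<otimes> ?d [^] Suc n, b \<noteq> odd (card {j. j < 2 * Suc n \<and> ?P j}))"
    unfolding conj card e1 e2 by (simp del: nat_pow_Suc)
  finally show ?case .
qed

text \<open>By \<open>c\<close> the condition on \<open>j\<close> has period \<open>n\<close>, so
  the indices below \<open>2 * n\<close> pair up as \<open>j\<close> and \<open>j + n\<close>, and
  the sign is restored.\<close>

lemma signed_conj_pair_id:
  assumes st: "s \<in> R" "t \<in> R" and c: "(s \<otimes> t) [^] (n::nat) = \<one>"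
  shows "(signed_conj s \<circ> signed_conj t) ^^ n = id"
proof (rule ext)
  fix p :: "'a \<times> bool"
  obtain u b where p: "p = (u, b)" by (cases p)
  show "((signed_conj s \<circ> signed_conj t) ^^ n) p = id p"
  proof (cases "u \<in> carrier W")
    case False
    have "((signed_conj s \<circ> signed_conj t) ^^ k) p = p" for k
      by (induction k) (use False p in \<open>auto simp: signed_conj_def\<close>)
    then show ?thesis by simp
  next
    case u: True
    let ?P = "\<lambda>j::nat. (s \<otimes> t) [^] j \<otimes> u = t"
    have per: "?P (j + n) \<longleftrightarrow> ?P j" for j
      using st c by (simp add: nat_pow_mult[symmetric])
    have "{j. j < 2 * n \<and> ?P j} = {j. j < n \<and> ?P j} \<union> (\<lambda>j. j + n) ` {j. j < n \<and> ?P j}"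
      (is "?L = ?A \<union> ?B")
    proof
      show "?L \<subseteq> ?A \<union> ?B"
      proof
        fix j assume j: "j \<in> ?L"
        show "j \<in> ?A \<union> ?B"
        proof (cases "j < n")
          case False
          then have "j = (j - n) + n" "j - n < n" using j by auto
          then show ?thesis using j per[of "j - n"] by (auto intro!: image_eqI[of _ _ "j - n"])
        qed (use j in auto)
      qed
      show "?A \<union> ?B \<subseteq> ?L" using per by auto
    qed
    moreover have "card (?A \<union> ?B) = card ?A + card ?B"
      by (rule card_Un_disjoint) auto
    ultimately have "card {j. j < 2 * n \<and> ?P j} = 2 * card {j. j < n \<and> ?P j}"
      by (simp add: card_image)
    moreover have "(t \<otimes> s) [^] n = \<one>"
    proof -
      have "t \<otimes> s = inv (s \<otimes> t)" using st by (simp add: inv_mult_group)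
      then show ?thesis using c st by (simp add: nat_pow_inv)
    qed
    ultimately show ?thesis
      unfolding p signed_conj_pair_pow[OF st u] using c u by simp
  qed
qed

text \<open>The signed action satisfies the defining relations, so it descends from words to
  elements of \<open>W\<close>. This lets any word be replaced by a reduced one.\<close>

lemma foldr_signed_conj_cong:
  assumes "set us \<subseteq> R" "set vs \<subseteq> R" "word_prod us = word_prod vs"
  shows "foldr signed_conj us = foldr signed_conj vs"
proof -
  obtain m where m: "\<And>s t. s \<in> R \<Longrightarrow> t \<in> R \<Longrightarrow> (s \<otimes> t) [^] (m s t :: nat) = \<one>"
    and eq: "pres_equiv R (coxeter_relators R m)
      (map (\<lambda>s. (s, True)) us) (map (\<lambda>s. (s, True)) vs)"
    using coxeter_exponents assms by metis
  have "foldr (\<lambda>l. signed_conj (fst l)) (map (\<lambda>s. (s, True)) us) =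
      foldr (\<lambda>l. signed_conj (fst l)) (map (\<lambda>s. (s, True)) vs)"
    by (rule foldr_pres_equiv[OF signed_conj_square _ eq])
      (auto intro: signed_conj_pair_id m)
  then show ?thesis by (simp add: foldr_map comp_def fun_eq_iff)
qed

lemma fst_foldr_signed_conj:
  assumes "set rs \<subseteq> R" "u \<in> carrier W"
  shows "fst (foldr signed_conj rs (u, b)) \<in> carrier W \<and>
    fst (foldr signed_conj rs (u, b)) \<otimes> word_prod rs = word_prod rs \<otimes> u"
  using assms by (induction rs) (auto simp: signed_conj_def m_assoc)

text \<open>Letters act from the right end of the word. A letter \<open>a\<close> flips the sign
  only if the conjugate of \<open>u\<close> by the suffix after it equals \<open>a\<close>; then
  multiplying that suffix by \<open>u\<close> on the right amounts to putting \<open>a\<close> in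
  front, which cancels the letter \<open>a\<close> of the word.\<close>

lemma sign_change_deletion:
  assumes "set rs \<subseteq> R" "u \<in> carrier W" "snd (foldr signed_conj rs (u, b)) \<noteq> b"
  shows "\<exists>ys a zs. rs = ys @ a # zs \<and> word_prod rs \<otimes> u = word_prod (ys @ zs)"
  using assms
proof (induction rs)
  case (Cons a rs)
  show ?case
  proof (cases "snd (foldr signed_conj rs (u, b)) = b")
    case True
    then obtain v where v: "foldr signed_conj rs (u, b) = (v, b)"
      by (cases "foldr signed_conj rs (u, b)") auto
    have p: "word_prod rs \<in> carrier W" "a \<in> R" using Cons.prems by auto
    have vc: "v \<in> carrier W" and "v \<otimes> word_prod rs = word_prod rs \<otimes> u"
      using fst_foldr_signed_conj[of rs u b] Cons.prems v by simp_all
    moreover have "v = a"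
    proof -
      have "signed_conj a (v, b) = (a \<otimes> v \<otimes> a, b \<noteq> (v = a))"
        using vc by (simp add: signed_conj_def)
      then show ?thesis using Cons.prems(3) v by auto
    qed
    ultimately have "word_prod rs \<otimes> u = a \<otimes> word_prod rs" by simp
    then have "word_prod (a # rs) \<otimes> u = word_prod rs"
      using p Cons.prems(2) by (simp add: m_assoc)
    then show ?thesis by (intro exI[of _ "[]"]) auto
  next
    case False
    then obtain ys a' zs where
      "rs = ys @ a' # zs" and eq: "word_prod rs \<otimes> u = word_prod (ys @ zs)"
      using Cons.IH Cons.prems(1,2) by (auto simp del: foldr_append)
    moreover have "word_prod (a # rs) \<otimes> u = word_prod ((a # ys) @ zs)"
      using Cons.prems eq by (simp add: m_assoc)
    ultimately show ?thesis by (metis append_Cons)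
  qed
qed simp

section \<open>Elementary properties of the length\<close>

lemma word_exists:
  assumes "w \<in> carrier W"
  obtains rs where "set rs \<subseteq> R" "word_prod rs = w"
proof -
  have "w \<in> generate W R"
    using cox assms by (auto simp: coxeter_system_def has_presentation_def)
  then have "\<exists>rs. set rs \<subseteq> R \<and> word_prod rs = w"
  proof induction
    case one
    show ?case by (intro exI[of _ "[]"]) auto
  next
    case (incl s)
    then show ?case by (intro exI[of _ "[s]"]) auto
  next
    case (inv s)
    then show ?case by (intro exI[of _ "[s]"]) auto
  next
    case (eng g h)
    then show ?case by (metis word_prod_append set_append Un_least)
  qed
  then show thesis using that by auto
qed

lemma len_le: "set rs \<subseteq> R \<Longrightarrow> len (word_prod rs) \<le> length rs"
  unfolding cox_length_def by (rule Least_le) auto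

lemma reduced_word:
  assumes "w \<in> carrier W"
  obtains rs where "set rs \<subseteq> R" "word_prod rs = w" "length rs = len w"
proof -
  obtain rs where "set rs \<subseteq> R" "word_prod rs = w" using word_exists[OF assms] .
  then have "\<exists>n rs. set rs \<subseteq> R \<and> length rs = n \<and> word_prod rs = w" by auto
  from LeastI_ex[OF this] show thesis using that by (auto simp: cox_length_def)
qed

lemma len_one [simp]: "len \<one> = 0"
  using len_le[of "[]"] by simp

lemma len_mult_le:
  assumes "x \<in> carrier W" "y \<in> carrier W"
  shows "len (x \<otimes> y) \<le> len x + len y"
proof -
  obtain us where "set us \<subseteq> R" "word_prod us = x" "length us = len x"
    using reduced_word[OF assms(1)] .
  moreover obtain vs where "set vs \<subseteq> R" "word_prod vs = y" "length vs = len y"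
    using reduced_word[OF assms(2)] .
  ultimately show ?thesis
    using len_le[of "us @ vs"] word_prod_append[of us vs] by auto
qed

lemma len_inv [simp]:
  assumes "x \<in> carrier W"
  shows "len (inv x) = len x"
proof -
  have le: "len (inv y) \<le> len y" if y: "y \<in> carrier W" for y
  proof -
    obtain us where "set us \<subseteq> R" "word_prod us = y" "length us = len y"
      using reduced_word[OF y] .
    then show ?thesis using len_le[of "rev us"] word_prod_rev[of us] by auto
  qed
  show ?thesis using le[of x] le[of "inv x"] assms by simp
qed

section \<open>Descents and the exchange condition\<close>

text \<open>A changed sign deletes a letter from a reduced word of the same element, which gives the
  descent. An unchanged sign is a changed one for \<open>rs @ [s]\<close>, since the last
  \<open>s\<close> flips first; the ascent is thus a descent read backwards.\<close>

lemma len_right_sign: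
  assumes rs: "set rs \<subseteq> R" and s: "s \<in> R"
  shows "\<not> snd (foldr signed_conj rs (s, True)) \<Longrightarrow> len (word_prod rs \<otimes> s) < len (word_prod rs)"
    and "snd (foldr signed_conj rs (s, True)) \<Longrightarrow> len (word_prod rs) < len (word_prod rs \<otimes> s)"
proof -
  have drop: "len (word_prod us \<otimes> s) < len (word_prod us)"
    if us: "set us \<subseteq> R" and sgn: "snd (foldr signed_conj us (s, b)) \<noteq> b" for us b
  proof -
    obtain vs where vs: "set vs \<subseteq> R" "word_prod vs = word_prod us" "length vs = len (word_prod us)"
      using reduced_word[of "word_prod us"] us by auto
    then have "foldr signed_conj vs = foldr signed_conj us"
      using foldr_signed_conj_cong us by blast
    then obtain ys a zs where "vs = ys @ a # zs" "word_prod vs \<otimes> s = word_prod (ys @ zs)"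
      using sign_change_deletion[of vs s b] vs(1) sgn s by (auto simp del: foldr_append)
    then show ?thesis using vs len_le[of "ys @ zs"] by auto
  qed
  show "len (word_prod rs \<otimes> s) < len (word_prod rs)" if "\<not> snd (foldr signed_conj rs (s, True))"
    using drop[of rs True] rs that by auto
  assume "snd (foldr signed_conj rs (s, True))"
  then have "snd (foldr signed_conj (rs @ [s]) (s, False)) \<noteq> False"
    using s by (simp add: signed_conj_def)
  then have "len (word_prod (rs @ [s]) \<otimes> s) < len (word_prod (rs @ [s]))"
    using drop[of "rs @ [s]" False] rs s by auto
  then show "len (word_prod rs) < len (word_prod rs \<otimes> s)"
    using rs s by (simp add: word_prod_append m_assoc del: foldr_append)
qed

lemma exchange_right:
  assumes rs: "set rs \<subseteq> R" and s: "s \<in> R" and le: "len (word_prod rs \<otimes> s) \<le> len (word_prod rs)"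
  obtains ys a zs where "rs = ys @ a # zs" "word_prod rs \<otimes> s = word_prod (ys @ zs)"
proof -
  have "snd (foldr signed_conj rs (s, True)) \<noteq> True"
    using len_right_sign(2)[OF rs s] le by (metis not_le)
  from sign_change_deletion[OF rs R_closed[OF s] this] that show thesis by blast
qed

text \<open>Inversion turns this into \<open>exchange_right\<close> for the reversed word.\<close>

lemma exchange_left:
  assumes rs: "set rs \<subseteq> R" and s: "s \<in> R" and le: "len (s \<otimes> word_prod rs) \<le> len (word_prod rs)"
  obtains ys a zs where "rs = ys @ a # zs" "s \<otimes> word_prod rs = word_prod (ys @ zs)"
proof -
  have inv: "word_prod (rev rs) \<otimes> s = inv (s \<otimes> word_prod rs)"
    using rs s by (simp add: word_prod_rev inv_mult_group)
  have "len (word_prod (rev rs) \<otimes> s) \<le> len (word_prod (rev rs))"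
    using le rs s unfolding inv by (simp add: word_prod_rev)
  then obtain ys a zs where e: "rev rs = ys @ a # zs" "word_prod (rev rs) \<otimes> s = word_prod (ys @ zs)"
    using exchange_right[of "rev rs" s] rs s by (auto simp del: foldr_append)
  have rs': "rs = rev zs @ a # rev ys"
    using arg_cong[OF e(1), of rev] by simp
  moreover have "s \<otimes> word_prod rs = word_prod (rev zs @ rev ys)"
  proof -
    have "s \<otimes> word_prod rs = inv (word_prod (ys @ zs))"
      using inv e(2) rs s by (metis R_closed inv_inv m_closed word_prod_closed)
    also have "\<dots> = word_prod (rev (ys @ zs))"
      using rs rs' by (subst word_prod_rev) auto
    finally show ?thesis by (simp del: foldr_append)
  qed
  ultimately show thesis using that by blast
qed

text \<open>The empty word changes no sign, so \<open>s\<close> is longer than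
  \<open>\<one>\<close>. In particular generators are nontrivial, which the presentation does not
  state outright.\<close>

lemma len_reflection [simp]:
  assumes "s \<in> R" shows "len s = 1"
proof -
  have "len \<one> < len (\<one> \<otimes> s)"
    using len_right_sign(2)[of "[]" s] assms by simp
  moreover have "len s \<le> 1" using len_le[of "[s]"] assms by simp
  ultimately show ?thesis using assms by simp
qed

text \<open>The sign criterion excludes equal lengths, and subadditivity bounds the difference by
  one.\<close>

lemma len_right_cases:
  assumes "w \<in> carrier W" "s \<in> R"
  shows "len (w \<otimes> s) = Suc (len w) \<or> len w = Suc (len (w \<otimes> s))"
proof -
  obtain rs where "set rs \<subseteq> R" "word_prod rs = w" using word_exists[OF assms(1)] .
  then have "len (w \<otimes> s) \<noteq> len w"
    using len_right_sign[of rs s] assms by (metis less_irrefl)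
  moreover have "len (w \<otimes> s) \<le> len w + 1"
    using len_mult_le[of w s] assms by simp
  moreover have "len w \<le> len (w \<otimes> s) + 1"
    using len_mult_le[of "w \<otimes> s" s] assms by (simp add: m_assoc)
  ultimately show ?thesis by linarith
qed

lemma len_left_cases:
  assumes "w \<in> carrier W" "s \<in> R"
  shows "len (s \<otimes> w) = Suc (len w) \<or> len w = Suc (len (s \<otimes> w))"
  using len_right_cases[of "inv w" s] len_inv[of "s \<otimes> w"] assms by (simp add: inv_mult_group)

text \<open>If the length does not grow again, exchange deletes a letter from \<open>s # rs\<close>,
  where \<open>rs\<close> is a reduced word of \<open>y\<close>. Deleting the first \<open>s\<close>
  makes \<open>s\<close> and \<open>y\<close> commute; deleting a later letter would make
  \<open>y \<otimes> s\<close> shorter than \<open>y\<close>.\<close>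

lemma len_conj_ascent:
  assumes y: "y \<in> carrier W" and s: "s \<in> R"
    and l: "len (s \<otimes> y) = Suc (len y)" and r: "len (y \<otimes> s) = Suc (len y)"
  shows "len (s \<otimes> y \<otimes> s) = len y + 2 \<or> s \<otimes> y = y \<otimes> s"
proof (cases "len (s \<otimes> y \<otimes> s) \<le> len (s \<otimes> y)")
  case False
  then show ?thesis using len_right_cases[of "s \<otimes> y" s] y s l by auto
next
  case True
  obtain rs where rs: "set rs \<subseteq> R" "word_prod rs = y" "length rs = len y"
    using reduced_word[OF y] .
  obtain ys a zs where e: "s # rs = ys @ a # zs" "word_prod (s # rs) \<otimes> s = word_prod (ys @ zs)"
    using exchange_right[of "s # rs" s] rs s True by auto
  show ?thesis
  proof (cases ys)
    case Nil
    then have "s \<otimes> y \<otimes> s = y" using e rs by simp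
    then show ?thesis using y s by (metis R_closed R_square m_assoc m_closed r_one)
  next
    case (Cons s' ys')
    then have ys: "ys = s # ys'" "rs = ys' @ a # zs" using e by auto
    have "s \<otimes> (y \<otimes> s) = s \<otimes> word_prod (ys' @ zs)"
      using e(2) rs y s ys by (simp add: m_assoc)
    then have "s \<otimes> (s \<otimes> (y \<otimes> s)) = s \<otimes> (s \<otimes> word_prod (ys' @ zs))" by simp
    then have "y \<otimes> s = word_prod (ys' @ zs)"
      using y s rs ys by (simp del: foldr_append)
    then show ?thesis using len_le[of "ys' @ zs"] rs ys r by simp
  qed
qed

section \<open>Involutions and the partner map\<close>

lemma involutions_iff:
  "x \<in> involutions W \<longleftrightarrow> x \<in> carrier W \<and> x \<noteq> \<one> \<and> x \<otimes> x = \<one>"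
proof (cases "x \<in> carrier W")
  case x: True
  have sq: "x [^] (2::nat) = x \<otimes> x" using x by (simp add: numeral_2_eq_2)
  have "ord x = 2 \<longleftrightarrow> x \<noteq> \<one> \<and> x \<otimes> x = \<one>"
  proof
    assume "ord x = 2"
    then show "x \<noteq> \<one> \<and> x \<otimes> x = \<one>"
      using x sq pow_ord_eq_1[OF x] by auto
  next
    assume a: "x \<noteq> \<one> \<and> x \<otimes> x = \<one>"
    then have "ord x dvd 2" using x sq by (simp add: pow_eq_id[symmetric])
    moreover have "ord x \<noteq> 1" using a x ord_eq_1 by auto
    ultimately show "ord x = 2" using dvd_imp_le[of "ord x" 2] by (cases "ord x") auto
  qed
  then show ?thesis using x by (auto simp: involutions_def)
qed (auto simp: involutions_def)

lemma involution_inv: "x \<in> involutions W \<Longrightarrow> inv x = x"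
  by (auto simp: involutions_iff inv_equality)

lemma R_involution: "s \<in> R \<Longrightarrow> s \<in> involutions W"
  using len_reflection[of s] by (auto simp: involutions_iff simp del: len_reflection)

text \<open>For an involution \<open>y\<close>, the element \<open>y \<otimes> s\<close> is the
  inverse of \<open>s \<otimes> y\<close>.\<close>

lemma len_involution_right:
  "y \<in> involutions W \<Longrightarrow> s \<in> R \<Longrightarrow> len (y \<otimes> s) = len (s \<otimes> y)"
  using len_inv[of "s \<otimes> y"] involution_inv[of y]
  by (auto simp: inv_mult_group involutions_iff)

text \<open>Conjugation would fix the involutions commuting with \<open>s\<close>, so these are
  multiplied by \<open>s\<close> instead. The element \<open>s\<close> must be set aside because its
  partner is \<open>\<one>\<close>.\<close>

definition partner :: "'a \<Rightarrow> 'a \<Rightarrow> 'a" where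
  "partner s y = (if s \<otimes> y = y \<otimes> s then s \<otimes> y else s \<otimes> y \<otimes> s)"

text \<open>Each branch preserves whether the element commutes with \<open>s\<close>, so the same
  branch applies twice.\<close>

lemma partner_partner:
  assumes "s \<in> R" "y \<in> carrier W"
  shows "partner s (partner s y) = y"
proof -
  have eqs: "s \<otimes> (s \<otimes> y) = y" "s \<otimes> y \<otimes> s \<otimes> s = s \<otimes> y" "s \<otimes> (s \<otimes> y \<otimes> s) = y \<otimes> s"
    "s \<otimes> (s \<otimes> y \<otimes> s) \<otimes> s = y"
    using assms by (simp_all add: m_assoc)
  show ?thesis
  proof (cases "s \<otimes> y = y \<otimes> s")
    case True
    then have "s \<otimes> (s \<otimes> y) = s \<otimes> y \<otimes> s" using assms by (metis R_closed m_assoc)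
    then show ?thesis using True eqs(1) by (simp add: partner_def)
  next
    case False
    then have "s \<otimes> (s \<otimes> y \<otimes> s) \<noteq> s \<otimes> y \<otimes> s \<otimes> s" by (simp only: eqs) auto
    then show ?thesis using False by (simp add: partner_def eqs(4))
  qed
qed

lemma partner_involution:
  assumes s: "s \<in> R" and y: "y \<in> involutions W" "y \<noteq> s"
  shows "partner s y \<in> involutions W" "partner s y \<noteq> s"
proof -
  have c: "y \<in> carrier W" "y \<noteq> \<one>" "y \<otimes> y = \<one>" using y by (auto simp: involutions_iff)
  then have yy: "y \<otimes> (y \<otimes> z) = z" if "z \<in> carrier W" for z
    using that by (simp add: m_assoc[symmetric])
  have nr: "s \<otimes> y \<noteq> \<one>" using y(2) c s by (metis R_closed R_square_left r_one)
  have ns: "s \<otimes> y \<noteq> s" using c s by (metis R_closed R_square_left R_square)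
  have n1: "s \<otimes> y \<otimes> s \<noteq> \<one>" using c s ns by (metis R_closed R_square m_closed right_cancel one_closed)
  have n2: "s \<otimes> y \<otimes> s \<noteq> s" using c s nr by (metis R_closed m_closed l_one one_closed right_cancel)
  have "s \<otimes> y \<otimes> (s \<otimes> y) = \<one>" if "s \<otimes> y = y \<otimes> s"
    using c s that by (metis R_closed R_square_left m_assoc m_closed)
  moreover have "s \<otimes> y \<otimes> s \<otimes> (s \<otimes> y \<otimes> s) = \<one>"
    using c s by (simp add: m_assoc yy)
  ultimately show "partner s y \<in> involutions W" "partner s y \<noteq> s"
    using c s nr ns n1 n2 by (auto simp: partner_def involutions_iff)
qed

text \<open>The length grows by 1 if \<open>s\<close> and \<open>y\<close> commute and otherwise by
  2, by \<open>len_conj_ascent\<close>. The upper bound is what later controls the partner of the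
  longest element.\<close>

lemma partner_ascent:
  assumes s: "s \<in> R" and y: "y \<in> involutions W" and asc: "len (s \<otimes> y) = Suc (len y)"
  shows "len y < len (partner s y)" "len (partner s y) = Suc (len (s \<otimes> partner s y))"
    "len (partner s y) \<le> len y + 2"
proof -
  have c: "y \<in> carrier W" using y by (auto simp: involutions_iff)
  have r: "len (y \<otimes> s) = Suc (len y)" using len_involution_right[OF y s] asc by simp
  have "len (s \<otimes> y \<otimes> s) = len y + 2" if "s \<otimes> y \<noteq> y \<otimes> s"
    using len_conj_ascent[OF c s asc r] that by auto
  moreover have "s \<otimes> (s \<otimes> y \<otimes> s) = y \<otimes> s" "s \<otimes> (s \<otimes> y) = y" using c s by (simp_all add: m_assoc)
  ultimately show "len y < len (partner s y)" "len (partner s y) = Suc (len (s \<otimes> partner s y))"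
    "len (partner s y) \<le> len y + 2"
    using asc r by (cases "s \<otimes> y = y \<otimes> s"; simp add: partner_def)+
qed

lemma partner_descent:
  assumes s: "s \<in> R" and y: "y \<in> involutions W" and desc: "len y = Suc (len (s \<otimes> y))"
  shows "len (s \<otimes> partner s y) = Suc (len (partner s y))"
proof (cases "s \<otimes> y = y \<otimes> s")
  case True
  have "s \<otimes> (s \<otimes> y) = y" using y s by (simp add: involutions_iff)
  then show ?thesis using True desc by (simp add: partner_def)
next
  case False
  have c: "y \<in> carrier W" using y by (auto simp: involutions_iff)
  have r: "len (y \<otimes> s) = len (s \<otimes> y)" using len_involution_right[OF y s] .
  have "len (s \<otimes> y) = Suc (len (s \<otimes> y \<otimes> s))"
  proof (rule ccontr)
    assume "len (s \<otimes> y) \<noteq> Suc (len (s \<otimes> y \<otimes> s))"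
    then have "len (s \<otimes> y \<otimes> s) = Suc (len (s \<otimes> y))"
      using len_right_cases[of "s \<otimes> y" s] c s by auto
    \<comment> \<open>Here \<open>s \<otimes> y\<close> would have ascents on both sides. Its
      conjugate \<open>y \<otimes> s\<close> has the same length as \<open>s \<otimes> y\<close>, so
      only the commuting alternative is left.\<close>
    then have "len (s \<otimes> (s \<otimes> y) \<otimes> s) = len (s \<otimes> y) + 2 \<or> s \<otimes> (s \<otimes> y) = s \<otimes> y \<otimes> s"
      using c s desc by (intro len_conj_ascent) auto
    then have "s \<otimes> (s \<otimes> (s \<otimes> y)) = s \<otimes> (s \<otimes> y \<otimes> s)" using c s r by simp
    then have "s \<otimes> y = y \<otimes> s" using c s by (simp add: m_assoc)
    then show False using False by simp
  qed
  then show ?thesis using False c s r by (simp add: partner_def m_assoc)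
qed

section \<open>The longest element\<close>

text \<open>The prefix is built from its right end: given \<open>z = word_prod (us @ vs)\<close>,
  left exchange with \<open>t\<close> deletes some letter, and putting \<open>t\<close> in front
  gives \<open>z\<close> back.\<close>

lemma reduced_word_prefix:
  assumes z: "z \<in> carrier W" and desc: "\<And>s. s \<in> R \<Longrightarrow> len (s \<otimes> z) \<le> len z"
    and us: "set us \<subseteq> R" "len (word_prod us) = length us"
  shows "\<exists>vs. set vs \<subseteq> R \<and> z = word_prod (us @ vs) \<and> length (us @ vs) = len z"
  using us
proof (induction us)
  case Nil
  obtain rs where "set rs \<subseteq> R" "word_prod rs = z" "length rs = len z"
    using reduced_word[OF z] .
  then show ?case by auto
next
  case (Cons t us)
  have red: "len (word_prod us) = length us"
    using Cons.prems len_le[of us] len_mult_le[of t "word_prod us"] by auto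
  then obtain vs where vs: "set vs \<subseteq> R" "z = word_prod (us @ vs)" "length (us @ vs) = len z"
    using Cons by auto
  obtain ys a zs where e: "us @ vs = ys @ a # zs" "t \<otimes> word_prod (us @ vs) = word_prod (ys @ zs)"
    using exchange_left[of "us @ vs" t] desc[of t] vs Cons.prems by auto
  consider ws where "us = ys @ a # ws" "zs = ws @ vs" | ws where "ys = us @ ws" "vs = ws @ a # zs"
    using e(1) by (auto simp: append_eq_append_conv2 append_eq_Cons_conv Cons_eq_append_conv)
  then show ?case
  proof cases
    \<comment> \<open>A deletion inside \<open>us\<close> would write \<open>t # us\<close> with
      fewer letters, against its reducedness.\<close>
    case 1
    have "t \<otimes> word_prod us \<otimes> word_prod vs = word_prod (ys @ ws) \<otimes> word_prod vs"
      using e(2) 1 vs Cons.prems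
      by (auto simp: word_prod_append m_assoc simp del: foldr_append)
    then have "word_prod (t # us) = word_prod (ys @ ws)"
      using 1 vs Cons.prems word_prod_closed[of us] word_prod_closed[of "ys @ ws"]
      by (subst (asm) right_cancel) (auto simp del: foldr_append)
    then show ?thesis using len_le[of "ys @ ws"] 1 Cons.prems by auto
  next
    \<comment> \<open>A deletion inside \<open>vs\<close> leaves \<open>us\<close> intact, so
      \<open>t # us\<close> is a prefix.\<close>
    case 2
    have "z = t \<otimes> (t \<otimes> z)" using z Cons.prems by simp
    also have "\<dots> = word_prod ((t # us) @ ws @ zs)"
      using e(2) 2 vs by simp
    finally show ?thesis using 2 vs by (intro exI[of _ "ws @ zs"]) auto
  qed
qed

lemma len_le_of_all_descents:
  assumes "z \<in> carrier W" "\<And>s. s \<in> R \<Longrightarrow> len (s \<otimes> z) \<le> len z" "w \<in> carrier W"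
  shows "len w \<le> len z"
proof -
  obtain us where us: "set us \<subseteq> R" "word_prod us = w" "length us = len w"
    using reduced_word[OF assms(3)] .
  then obtain vs where "length (us @ vs) = len z"
    using reduced_word_prefix[of z us] assms by auto
  then show ?thesis using us by simp
qed

text \<open>A longest involution has no left ascent \<open>s\<close>, since its partner under
  \<open>s\<close> would be a longer involution. Without ascents it is longest in all of
  \<open>W\<close>.\<close>

lemma longest_involution:
  assumes fin: "finite (carrier W)" and "R \<noteq> {}"
  obtains z where "z \<in> involutions W" "\<And>w. w \<in> carrier W \<Longrightarrow> len w \<le> len z"
proof -
  have "finite (involutions W)" using fin by (auto simp: involutions_def)
  moreover have "involutions W \<noteq> {}" using assms R_involution by auto
  ultimately have "Max (len ` involutions W) \<in> len ` involutions W"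
    and "\<And>y. y \<in> involutions W \<Longrightarrow> len y \<le> Max (len ` involutions W)"
    by simp_all
  then obtain z where z: "z \<in> involutions W" and max: "\<And>y. y \<in> involutions W \<Longrightarrow> len y \<le> len z"
    by auto
  have zc: "z \<in> carrier W" using z by (simp add: involutions_iff)
  have "len (s \<otimes> z) \<le> len z" if s: "s \<in> R" for s
  proof (rule ccontr)
    assume "\<not> len (s \<otimes> z) \<le> len z"
    then have asc: "len (s \<otimes> z) = Suc (len z)" using len_left_cases[OF zc s] by auto
    \<comment> \<open>\<open>s \<otimes> s\<close> has length 0, so \<open>s\<close> is no ascent of
      itself.\<close>
    then have "z \<noteq> s" using s by auto
    then show False
      using partner_ascent(1)[OF s z asc] partner_involution(1)[OF s z] max by fastforce
  qed
  then show thesis using that[OF z] len_le_of_all_descents[OF zc] by blast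
qed

section \<open>Counting neighbours\<close>

text \<open>The \<open>Suc\<close> accounts for \<open>r\<close> itself; \<open>partner r\<close>
  matches the ascents with the descents among the other involutions.\<close>

lemma card_Delta1_reflection:
  assumes fin: "finite (carrier W)" and r: "r \<in> R"
  shows "card (involutions W) = Suc (2 * card (Delta1 W R r))"
proof -
  let ?A = "Delta1 W R r"
  let ?B = "{y \<in> involutions W - {r}. len y = Suc (len (r \<otimes> y))}"
  have finI: "finite (involutions W)" using fin by (auto simp: involutions_def)
  have A: "?A = {y \<in> involutions W - {r}. len (r \<otimes> y) = Suc (len y)}"
    using r by (auto simp: Delta1_def)
  have c: "y \<in> involutions W \<Longrightarrow> y \<in> carrier W" for y by (simp add: involutions_iff)
  have "bij_betw (partner r) ?A ?B"
    unfolding A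
    by (rule bij_betw_byWitness[where f' = "partner r"])
      (use r c partner_partner partner_involution partner_ascent(2) partner_descent in auto)
  then have eq: "card ?A = card ?B" by (rule bij_betw_same_card)
  have I: "involutions W = insert r (?A \<union> ?B)"
    unfolding A using r R_involution len_left_cases c by auto
  have disj: "r \<notin> ?A \<union> ?B" "?A \<inter> ?B = {}" "finite ?A" "finite ?B"
    unfolding A using finI by auto
  have "card (involutions W) = Suc (card (?A \<union> ?B))"
    by (subst I, rule card_insert_disjoint) (use disj in auto)
  also have "card (?A \<union> ?B) = card ?A + card ?B"
    using disj by (intro card_Un_disjoint)
  finally show ?thesis using eq by simp
qed

lemma Delta1_strict_subset_reflection:
  assumes fin: "finite (carrier W)" and x: "x \<in> involutions W" "x \<notin> R"
  shows "\<exists>r\<in>R. Delta1 W R x \<subset> Delta1 W R r"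
proof -
  have xc: "x \<in> carrier W" "x \<noteq> \<one>" "x \<otimes> x = \<one>" using x by (auto simp: involutions_iff)
  obtain rs where rs: "set rs \<subseteq> R" "word_prod rs = x" "length rs = len x"
    using reduced_word[OF xc(1)] .
  have "rs \<noteq> []" using rs xc by auto
  then obtain us r where us: "rs = us @ [r]" by (metis rev_exhaust)
  have r: "r \<in> R" using us rs by auto
  have xr: "x \<otimes> r = word_prod us"
    using us rs r by (auto simp: word_prod_append m_assoc simp del: foldr_append)
  have lxr: "len x = Suc (len (x \<otimes> r))"
    using len_right_cases[OF xc(1) r] xr us rs len_le[of us] by auto
  have us_ne: "us \<noteq> []" using us rs x r by auto
  have sub: "Delta1 W R x \<subseteq> Delta1 W R r"
  proof
    fix y assume y: "y \<in> Delta1 W R x"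
    then have yc: "y \<in> carrier W" by (simp add: Delta1_def involutions_iff)
    \<comment> \<open>Factoring through \<open>r\<close> loses one letter in
      \<open>x \<otimes> r\<close>, so additivity for \<open>x\<close> and \<open>y\<close> forces
      \<open>r \<otimes> y\<close> to be longer than \<open>y\<close>.\<close>
    have "len (x \<otimes> y) \<le> len (x \<otimes> r) + len (r \<otimes> y)"
      using len_mult_le[of "x \<otimes> r" "r \<otimes> y"] xc yc r by (simp add: m_assoc)
    then have "len (r \<otimes> y) = Suc (len y)"
      using y lxr len_left_cases[OF yc r] by (auto simp: Delta1_def)
    then show "y \<in> Delta1 W R r" using y r by (simp add: Delta1_def)
  qed
  have "\<exists>y \<in> Delta1 W R r. y \<notin> Delta1 W R x"
  proof (cases "length us = 1")
    case True
    then obtain s where s: "us = [s]" by (cases us) auto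
    then have sR: "s \<in> R" and "x = s \<otimes> r" using us rs r by auto
    \<comment> \<open>An involution equals its inverse, so \<open>s\<close> and \<open>r\<close>
      commute and \<open>x \<otimes> s\<close> collapses to \<open>r\<close>.\<close>
    then have "inv x = r \<otimes> s" using r by (simp add: inv_mult_group)
    then have x': "x = r \<otimes> s" using involution_inv[OF x(1)] by simp
    have "s \<in> Delta1 W R r"
      using R_involution[OF sR] x' rs us s r sR by (simp add: Delta1_def)
    moreover have "x \<otimes> s = r" using x' r sR by (simp add: m_assoc)
    then have "s \<notin> Delta1 W R x"
      using r sR lxr by (simp add: Delta1_def)
    ultimately show ?thesis by blast
  next
    case False
    then have lx: "len x \<ge> 3" using us_ne rs us by (cases us) (auto simp: neq_Nil_conv Suc_le_eq)
    obtain z where z: "z \<in> involutions W" and max: "\<And>w. w \<in> carrier W \<Longrightarrow> len w \<le> len z"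
      using longest_involution[OF fin] r by blast
    have zc: "z \<in> carrier W" using z by (simp add: involutions_iff)
    have "z \<noteq> r" using max[OF xc(1)] lx r by auto
    have desc: "len z = Suc (len (r \<otimes> z))"
      using len_left_cases[OF zc r] max[of "r \<otimes> z"] zc r by auto
    define y where "y = partner r z"
    have y: "y \<in> involutions W" using partner_involution[OF r z \<open>z \<noteq> r\<close>] y_def by simp
    have asc: "len (r \<otimes> y) = Suc (len y)" using partner_descent[OF r z desc] y_def by simp
    have "partner r y = z" using partner_partner[OF r zc] y_def by simp
    then have "len z \<le> len y + 2" using partner_ascent(3)[OF r y asc] by simp
    \<comment> \<open>Additivity would give \<open>len (x \<otimes> y) \<ge> len y + 3\<close>,
      exceeding the maximum \<open>len z \<le> len y + 2\<close>.\<close>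
    moreover have "len (x \<otimes> y) \<le> len z" using y xc by (intro max) (simp add: involutions_iff)
    ultimately have "y \<notin> Delta1 W R x" using lx by (simp add: Delta1_def)
    moreover have "y \<in> Delta1 W R r" using y asc r by (simp add: Delta1_def)
    ultimately show ?thesis by blast
  qed
  then show ?thesis using sub r by blast
qed

end

theorem corollary1p4:
  fixes W :: "('a, 'b) monoid_scheme" and R :: "'a set" and r :: 'a
  assumes "coxeter_system W R"
    and "finite (carrier W)"
    and "r \<in> R"
  shows "real (card (Delta1 W R r)) = (real (card (involutions W)) - 1) / 2 \<and>
    (\<forall>x \<in> involutions W - R.
       real (card (Delta1 W R x)) < (real (card (involutions W)) - 1) / 2)"
proof -
  interpret coxeter_group W R
    using assms(1)
    by (auto simp: coxeter_group_def coxeter_group_axioms_def coxeter_system_def has_presentation_def)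
  have eq: "real (card (Delta1 W R s)) = (real (card (involutions W)) - 1) / 2" if "s \<in> R" for s
    using card_Delta1_reflection[OF assms(2) that] by simp
  have "real (card (Delta1 W R x)) < (real (card (involutions W)) - 1) / 2"
    if x: "x \<in> involutions W - R" for x
  proof -
    obtain s where s: "s \<in> R" "Delta1 W R x \<subset> Delta1 W R s"
      using Delta1_strict_subset_reflection[OF assms(2), of x] x by blast
    have "finite (Delta1 W R s)"
      using assms(2) by (auto simp: Delta1_def involutions_def)
    then have "card (Delta1 W R x) < card (Delta1 W R s)" using s psubset_card_mono by blast
    then show ?thesis using eq[OF s(1)] by simp
  qed
  then show ?thesis using eq[OF assms(3)] by blast
qed

end
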